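(* Let $k$ be a field and $A$ a $k$-algebra. An ideal $I$ of $A$ is special if and only if $I=\sqrt[s]{I}$.
   Context: All rings are commutative and unital. The homogeneous signature $\mathcal H$ of $k$ is the set of all non-zero homogeneous polynomials $P(\bar X,Y)$ over $k$ in finitely many variables $\bar X=(X_1,\ldots,X_n)$ and a distinguished variable $Y$ such that for all $\bar a\in k^n$ and $b\in k$, $P(\bar a,b)=0$ implies $b=0$. An ideal $I$ of a $k$-algebra $A$ is special if for all $P(\bar X,Y)\in\mathcal H$ and $\bar a,b$ from $A$ such that $P(\bar a,b)\in I$, we have $b\in I$. The special radical $\sqrt[s]{I}$ of an ideal $I$ of $A$ is the intersection of all special prime ideals of $A$ containing $I$ (equal to $A$ if there are none). *)

theory Defs
  imports "HOL-Algebra.Algebra"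
begin

text \<open>The variables are \<open>VarX i\<close> for \<open>1 \<le> i \<le> n\<close> and the distinguished variable \<open>VarY\<close>.
  Polynomials are the indexed polynomials of HOL-Algebra: finitely supported functions from
  monomials (multisets of variables) to coefficients.\<close>

datatype signature_var = VarX nat | VarY

definition signature_vars :: "nat \<Rightarrow> signature_var set"
  where "signature_vars n = insert VarY (VarX ` {1..n})"

type_synonym 'k signature_poly = "signature_var multiset \<Rightarrow> 'k"

definition homogeneous_poly :: "('k, 'm) ring_scheme \<Rightarrow> ('v multiset \<Rightarrow> 'k) \<Rightarrow> bool"
  where "homogeneous_poly K P \<longleftrightarrow> (\<exists>d. \<forall>m. P m \<noteq> \<zero>\<^bsub>K\<^esub> \<longrightarrow> size m = d)"

text \<open>\<open>\<phi>\<close> maps the coefficients into \<open>S\<close>, as for \<^const>\<open>UnivPoly.eval\<close>.\<close>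

definition indexed_poly_eval ::
    "('k, 'm) ring_scheme \<Rightarrow> ('a, 'n) ring_scheme \<Rightarrow> ('k \<Rightarrow> 'a) \<Rightarrow> ('v \<Rightarrow> 'a) \<Rightarrow>
      ('v multiset \<Rightarrow> 'k) \<Rightarrow> 'a"
  where "indexed_poly_eval K S \<phi> v P =
    (\<Oplus>\<^bsub>S\<^esub> m \<in> {m. P m \<noteq> \<zero>\<^bsub>K\<^esub>}.
       \<phi> (P m) \<otimes>\<^bsub>S\<^esub> (\<Otimes>\<^bsub>S\<^esub> x \<in> set_mset m. v x [^]\<^bsub>S\<^esub> count m x))"

text \<open>\<open>P(a\<^sub>1, \<dots>, a\<^sub>n, b)\<close>, where \<open>a i\<close> is only relevant for \<open>1 \<le> i \<le> n\<close>.\<close>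

abbreviation signature_eval ::
    "('k, 'm) ring_scheme \<Rightarrow> ('a, 'n) ring_scheme \<Rightarrow> ('k \<Rightarrow> 'a) \<Rightarrow>
      'k signature_poly \<Rightarrow> (nat \<Rightarrow> 'a) \<Rightarrow> 'a \<Rightarrow> 'a"
  where "signature_eval K S \<phi> P a b \<equiv> indexed_poly_eval K S \<phi> (case_signature_var a b) P"

text \<open>The members of the homogeneous signature in the variables \<open>X\<^sub>1, \<dots>, X\<^sub>n, Y\<close>;
  the homogeneous signature is the union over all \<open>n\<close>.\<close>

definition homogeneous_signature :: "('k, 'm) ring_scheme \<Rightarrow> nat \<Rightarrow> 'k signature_poly set"
  where "homogeneous_signature K n =
    {P \<in> ring.indexed_pset K (signature_vars n) (carrier K).
       P \<noteq> ring.indexed_const K \<zero>\<^bsub>K\<^esub> \<and> homogeneous_poly K P \<and>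
       (\<forall>a \<in> {1..n} \<rightarrow> carrier K. \<forall>b \<in> carrier K.
          signature_eval K K (\<lambda>c. c) P a b = \<zero>\<^bsub>K\<^esub> \<longrightarrow> b = \<zero>\<^bsub>K\<^esub>)}"

definition special_ideal ::
    "('k, 'm) ring_scheme \<Rightarrow> ('k, 'a, 'n) module_scheme \<Rightarrow> 'a set \<Rightarrow> bool"
  where "special_ideal K A I \<longleftrightarrow> ideal I A \<and>
    (\<forall>n. \<forall>P \<in> homogeneous_signature K n. \<forall>a \<in> {1..n} \<rightarrow> carrier A. \<forall>b \<in> carrier A.
       signature_eval K A (\<lambda>c. c \<odot>\<^bsub>A\<^esub> \<one>\<^bsub>A\<^esub>) P a b \<in> I \<longrightarrow> b \<in> I)"

text \<open>Intersecting with the carrier only matters for the empty family.\<close>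

definition special_radical ::
    "('k, 'm) ring_scheme \<Rightarrow> ('k, 'a, 'n) module_scheme \<Rightarrow> 'a set \<Rightarrow> 'a set"
  where "special_radical K A I =
    carrier A \<inter> \<Inter>{Q. primeideal Q A \<and> special_ideal K A Q \<and> I \<subseteq> Q}"

end

theory Submission
  imports Defs
begin

text \<open>If \<open>I\<close> is special and \<open>b \<notin> I\<close>, take \<open>Q \<supseteq> I\<close> maximal among the special ideals that omit
  \<open>b\<close>. Homogeneity, in the form \<open>x\<^sup>d P(a, c) = P(x a, x c)\<close>, shows that every colon ideal
  \<open>(Q : x)\<close> is again special, so \<open>(Q : x)\<close> is \<open>Q\<close> or contains \<open>b\<close>. In the second case
  \<open>x \<in> (Q : b)\<close>, and \<open>(Q : b) = Q\<close> because \<open>Y\<^sup>2\<close> belongs to the signature and so \<open>b\<^sup>2 \<notin> Q\<close>.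
  Hence \<open>(Q : x) = Q\<close> for all \<open>x \<notin> Q\<close>, that is, \<open>Q\<close> is prime.\<close>

section \<open>Scaling of monomials and homogeneous polynomials\<close>

lemma (in comm_monoid) finprod_nat_pow:
  assumes "finite S" "c \<in> carrier G"
  shows "(\<Otimes>x\<in>S. c [^] (f x :: nat)) = c [^] sum f S"
  using assms by (induction S rule: finite_induct) (auto simp: nat_pow_mult)

text \<open>Each occurrence of a variable contributes one factor \<open>c\<close>, and the
  multiplicities add up to \<open>size m\<close>.\<close>

lemma (in comm_monoid) monomial_scale:
  assumes "c \<in> carrier G" "v \<in> set_mset m \<rightarrow> carrier G"
  shows "(\<Otimes>x\<in>set_mset m. (c \<otimes> v x) [^] count m x) =
    c [^] size m \<otimes> (\<Otimes>x\<in>set_mset m. v x [^] count m x)"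
proof -
  have "(\<Otimes>x\<in>set_mset m. (c \<otimes> v x) [^] count m x) =
      (\<Otimes>x\<in>set_mset m. c [^] count m x \<otimes> v x [^] count m x)"
    using assms by (intro finprod_cong') (auto simp: nat_pow_distrib Pi_iff)
  also have "\<dots> = (\<Otimes>x\<in>set_mset m. c [^] count m x) \<otimes> (\<Otimes>x\<in>set_mset m. v x [^] count m x)"
    using assms by (intro finprod_multf) auto
  finally show ?thesis
    using assms(1) by (simp add: finprod_nat_pow size_multiset_overloaded_eq)
qed

text \<open>Each constructor only introduces variables from \<open>J\<close>. This matters for
  evaluation, because a valuation is only known to lie in the carrier on the variables of the
  signature.\<close>

lemma (in ring) indexed_pset_support:
  assumes "P \<in> indexed_pset J K" "P m \<noteq> \<zero>"
  shows "set_mset m \<subseteq> J"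
  using assms
proof (induction arbitrary: m)
  case (indexed_const k)
  then show ?case by (auto simp: indexed_const_def split: if_splits)
next
  case (indexed_padd P Q)
  then show ?case by (force simp: indexed_padd_def)
next
  case (indexed_pmult P i)
  then have "i \<in># m" and "P (m - {#i#}) \<noteq> \<zero>"
    by (auto simp: indexed_pmult_def split: if_splits)
  then have "set_mset (m - {#i#}) \<subseteq> J"
    using indexed_pmult.IH by blast
  then show ?case
    using \<open>i \<in># m\<close> \<open>i \<in> J\<close> by (metis insert_DiffM insert_subset set_mset_add_mset_insert)
qed

text \<open>All monomials in the support have the same degree \<open>d\<close>, so the common factor
  \<open>c [^] d\<close> comes out of the sum.\<close>

lemma (in cring) indexed_poly_eval_scale:
  assumes c: "c \<in> carrier R"
    and deg: "\<And>m. P m \<noteq> \<zero>\<^bsub>K\<^esub> \<Longrightarrow> size m = d"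
    and \<phi>: "\<And>m. P m \<noteq> \<zero>\<^bsub>K\<^esub> \<Longrightarrow> \<phi> (P m) \<in> carrier R"
    and v: "\<And>m. P m \<noteq> \<zero>\<^bsub>K\<^esub> \<Longrightarrow> v \<in> set_mset m \<rightarrow> carrier R"
  shows "indexed_poly_eval K R \<phi> (\<lambda>x. c \<otimes> v x) P = c [^] d \<otimes> indexed_poly_eval K R \<phi> v P"
proof (cases "finite {m. P m \<noteq> \<zero>\<^bsub>K\<^esub>}")
  \<comment> \<open>Over an infinite support \<open>finsum\<close> defaults to zero, so both sides
    vanish.\<close>
  case False
  then show ?thesis
    using c by (simp add: indexed_poly_eval_def finsum_infinite)
next
  case True
  let ?t = "\<lambda>m. \<phi> (P m) \<otimes> (\<Otimes>x\<in>set_mset m. v x [^] count m x)"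
  have closed: "(\<Otimes>x\<in>set_mset m. v x [^] count m x) \<in> carrier R" if "P m \<noteq> \<zero>\<^bsub>K\<^esub>" for m
    using v[OF that] by (intro finprod_closed) auto
  have "\<phi> (P m) \<otimes> (\<Otimes>x\<in>set_mset m. (c \<otimes> v x) [^] count m x) = c [^] d \<otimes> ?t m"
    if "P m \<noteq> \<zero>\<^bsub>K\<^esub>" for m
    using monomial_scale[OF c v[OF that]] deg[OF that] \<phi>[OF that] closed[OF that] c
    by (simp add: m_lcomm)
  then have "indexed_poly_eval K R \<phi> (\<lambda>x. c \<otimes> v x) P =
      (\<Oplus>m\<in>{m. P m \<noteq> \<zero>\<^bsub>K\<^esub>}. c [^] d \<otimes> ?t m)"
    unfolding indexed_poly_eval_def using c \<phi> closed by (intro finsum_cong') auto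
  also have "\<dots> = c [^] d \<otimes> indexed_poly_eval K R \<phi> v P"
    unfolding indexed_poly_eval_def using True c \<phi> closed
    by (intro finsum_rdistr[symmetric]) auto
  finally show ?thesis .
qed

lemma (in cring) indexed_poly_eval_single:
  assumes "\<And>m'. P m' \<noteq> \<zero>\<^bsub>K\<^esub> \<longleftrightarrow> m' = m"
    and "\<phi> (P m) \<in> carrier R" "v \<in> set_mset m \<rightarrow> carrier R"
  shows "indexed_poly_eval K R \<phi> v P = \<phi> (P m) \<otimes> (\<Otimes>x\<in>set_mset m. v x [^] count m x)"
proof -
  have "(\<Otimes>x\<in>set_mset m. v x [^] count m x) \<in> carrier R"
    using assms(3) by (intro finprod_closed) auto
  then show ?thesis
    using assms(2) by (simp add: indexed_poly_eval_def assms(1))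
qed

section \<open>Special ideals: squares and colon ideals\<close>

text \<open>The polynomial is Y^2, which belongs to the signature because a field has no zero
  divisors. It involves no X, hence \<open>n = 0\<close>.\<close>

lemma (in field) Y_square_in_signature:
  "(\<lambda>m. if m = {#VarY, VarY#} then \<one> else \<zero>) \<in> homogeneous_signature R 0"
    (is "?P \<in> _")
proof -
  \<comment> \<open>Membership in \<open>indexed_pset\<close> is inductive, so Y^2 is rebuilt as the
    constant 1 multiplied twice by Y.\<close>
  have "?P = indexed_pmult (indexed_pmult (indexed_const \<one>) VarY) VarY"
  proof
    fix m :: "signature_var multiset"
    have "m = {#VarY, VarY#} \<longleftrightarrow> VarY \<in># m \<and> VarY \<in># m - {#VarY#} \<and> m - {#VarY#} - {#VarY#} = {#}"
      by (metis add_mset_remove_trivial insert_DiffM union_single_eq_member)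
    then show "?P m = indexed_pmult (indexed_pmult (indexed_const \<one>) VarY) VarY m"
      by (auto simp: indexed_pmult_def indexed_const_def)
  qed
  then have "?P \<in> indexed_pset (signature_vars 0) (carrier R)"
    by (simp add: signature_vars_def indexed_pset.intros)
  moreover have "?P \<noteq> indexed_const \<zero>"
    by (auto simp: indexed_const_def fun_eq_iff)
  moreover have "homogeneous_poly R ?P"
    by (auto simp: homogeneous_poly_def)
  moreover have "b = \<zero>" if "b \<in> carrier R" and "signature_eval R R (\<lambda>c. c) ?P a b = \<zero>" for a b
  proof -
    have "signature_eval R R (\<lambda>c. c) ?P a b = b [^] (2 :: nat)"
      using that(1) by (subst indexed_poly_eval_single[where m = "{#VarY, VarY#}"]) (auto simp: numeral_2_eq_2)
    then show ?thesis
      using that integral[of b b] by (auto simp: numeral_2_eq_2)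
  qed
  ultimately show ?thesis
    by (auto simp: homogeneous_signature_def)
qed

lemma special_idealD:
  assumes "special_ideal K A I" "P \<in> homogeneous_signature K n"
    and "a \<in> {1..n} \<rightarrow> carrier A" "b \<in> carrier A"
    and "signature_eval K A (\<lambda>c. c \<odot>\<^bsub>A\<^esub> \<one>\<^bsub>A\<^esub>) P a b \<in> I"
  shows "b \<in> I"
  using assms unfolding special_ideal_def by blast

lemma special_ideal_square:
  assumes "field K" "algebra K A" "special_ideal K A I" "b \<in> carrier A" "b \<otimes>\<^bsub>A\<^esub> b \<in> I"
  shows "b \<in> I"
proof -
  interpret field K by fact
  interpret A: cring A using assms(2) by (rule algebra.M_cring)
  interpret alg: algebra K A by fact
  let ?P = "\<lambda>m. if m = {#VarY, VarY#} then \<one>\<^bsub>K\<^esub> else \<zero>\<^bsub>K\<^esub>"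
  have "signature_eval K A (\<lambda>c. c \<odot>\<^bsub>A\<^esub> \<one>\<^bsub>A\<^esub>) ?P (\<lambda>_. b) b = b \<otimes>\<^bsub>A\<^esub> b"
    using assms(4)
    by (subst A.indexed_poly_eval_single[where m = "{#VarY, VarY#}"]) (auto simp: numeral_2_eq_2)
  \<comment> \<open>For \<open>n = 0\<close> the index set \<open>{1..n}\<close> is empty;
    \<open>\<lambda>_. b\<close> is an arbitrary choice for the X-values.\<close>
  then show ?thesis
    using special_idealD[OF assms(3) Y_square_in_signature, of "\<lambda>_. b" b] assms(4,5) by simp
qed

lemma (in cring) ideal_colon:
  assumes "ideal Q R" "x \<in> carrier R"
  shows "ideal {z \<in> carrier R. x \<otimes> z \<in> Q} R"
proof -
  interpret Q: ideal Q R by fact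
  show ?thesis
  proof (rule idealI)
    show "subgroup {z \<in> carrier R. x \<otimes> z \<in> Q} (add_monoid R)"
      using assms(2)
      by (unfold_locales) (auto simp: r_distr r_minus simp flip: a_inv_def)
    fix a y assume "a \<in> {z \<in> carrier R. x \<otimes> z \<in> Q}" "y \<in> carrier R"
    then show "y \<otimes> a \<in> {z \<in> carrier R. x \<otimes> z \<in> Q}" "a \<otimes> y \<in> {z \<in> carrier R. x \<otimes> z \<in> Q}"
      using assms(2) Q.I_l_closed[of "x \<otimes> a" y] by (auto simp: m_ac)
  qed (rule ring_axioms)
qed

text \<open>Let P have degree d. If d > 0 and x P(a, b) lies in Q, then so does x^d P(a, b) = P(x a,
  x b), and specialness of Q yields x b in Q. Constants in the signature are units and are treated
  directly.\<close>

lemma special_ideal_colon: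
  assumes "field K" "algebra K A" "special_ideal K A Q" "x \<in> carrier A"
  shows "special_ideal K A {z \<in> carrier A. x \<otimes>\<^bsub>A\<^esub> z \<in> Q}"
proof -
  interpret field K by fact
  interpret A: cring A using assms(2) by (rule algebra.M_cring)
  interpret alg: algebra K A by fact
  interpret Q: ideal Q A using assms(3) by (simp add: special_ideal_def)
  have "x \<otimes>\<^bsub>A\<^esub> b \<in> Q"
    if P: "P \<in> homogeneous_signature K n" and a: "a \<in> {1..n} \<rightarrow> carrier A" and b: "b \<in> carrier A"
      and ev: "signature_eval K A (\<lambda>c. c \<odot>\<^bsub>A\<^esub> \<one>\<^bsub>A\<^esub>) P a b \<in> carrier A"
        "x \<otimes>\<^bsub>A\<^esub> signature_eval K A (\<lambda>c. c \<odot>\<^bsub>A\<^esub> \<one>\<^bsub>A\<^esub>) P a b \<in> Q" (is "_ \<otimes>\<^bsub>A\<^esub> ?e \<in> _")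
    for n P a b
  proof -
    have pset: "P \<in> indexed_pset (signature_vars n) (carrier K)" and nz: "P \<noteq> indexed_const \<zero>\<^bsub>K\<^esub>"
      using P by (auto simp: homogeneous_signature_def)
    obtain d where d: "\<And>m. P m \<noteq> \<zero>\<^bsub>K\<^esub> \<Longrightarrow> size m = d"
      using P by (auto simp: homogeneous_signature_def homogeneous_poly_def)
    have coeff: "P m \<in> carrier K" for m
      using indexed_pset_in_carrier[OF subset_refl pset] by (simp add: carrier_coeff_def)
    show ?thesis
    proof (cases d)
      case 0
      \<comment> \<open>The empty monomial is the only one of size 0, and it does occur because P is
        nonzero.\<close>
      then have single: "P m \<noteq> \<zero>\<^bsub>K\<^esub> \<longleftrightarrow> m = {#}" for m
        using d nz by (metis indexed_zero_def size_eq_0_iff_empty ext)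
      then have unit: "P {#} \<in> Units K"
        using coeff field_Units by blast
      have "?e = P {#} \<odot>\<^bsub>A\<^esub> \<one>\<^bsub>A\<^esub>"
        using coeff by (subst A.indexed_poly_eval_single[where m = "{#}"]) (auto simp: single)
      \<comment> \<open>The image in A of the nonzero constant is invertible, so x itself can be
        recovered from \<open>x\<close> times \<open>?e\<close>, which lies in Q.\<close>
      moreover have "(inv\<^bsub>K\<^esub> P {#} \<odot>\<^bsub>A\<^esub> \<one>\<^bsub>A\<^esub>) \<otimes>\<^bsub>A\<^esub> (P {#} \<odot>\<^bsub>A\<^esub> \<one>\<^bsub>A\<^esub>) =
          \<one>\<^bsub>A\<^esub>"
        using unit coeff by (simp add: alg.smult_assoc2 alg.smult_assoc1[symmetric])
      ultimately have "(inv\<^bsub>K\<^esub> P {#} \<odot>\<^bsub>A\<^esub> \<one>\<^bsub>A\<^esub>) \<otimes>\<^bsub>A\<^esub> (x \<otimes>\<^bsub>A\<^esub> ?e) = x"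
        using unit coeff assms(4) by (simp add: A.m_lcomm)
      then have "x \<in> Q"
        using Q.I_l_closed[OF ev(2), of "inv\<^bsub>K\<^esub> P {#} \<odot>\<^bsub>A\<^esub> \<one>\<^bsub>A\<^esub>"] unit by simp
      then show ?thesis
        using b by (rule Q.I_r_closed)
    next
      case (Suc e)
      have "signature_eval K A (\<lambda>c. c \<odot>\<^bsub>A\<^esub> \<one>\<^bsub>A\<^esub>) P (\<lambda>i. x \<otimes>\<^bsub>A\<^esub> a i) (x \<otimes>\<^bsub>A\<^esub> b) =
          indexed_poly_eval K A (\<lambda>c. c \<odot>\<^bsub>A\<^esub> \<one>\<^bsub>A\<^esub>) (\<lambda>y. x \<otimes>\<^bsub>A\<^esub> case_signature_var a b y) P"
        by (rule arg_cong[where f = "\<lambda>v. indexed_poly_eval K A _ v P"])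
          (auto split: signature_var.split)
      also have "\<dots> = x [^]\<^bsub>A\<^esub> d \<otimes>\<^bsub>A\<^esub> ?e"
      proof (rule A.indexed_poly_eval_scale)
        fix m assume "P m \<noteq> \<zero>\<^bsub>K\<^esub>"
        then have "set_mset m \<subseteq> signature_vars n"
          by (rule indexed_pset_support[OF pset])
        then show "case_signature_var a b \<in> set_mset m \<rightarrow> carrier A"
          using a b by (force simp: signature_vars_def split: signature_var.split)
      qed (use assms(4) d coeff in auto)
      \<comment> \<open>One of the \<open>d = Suc e\<close> factors x is kept next to
        \<open>?e\<close>, since the hypothesis puts only that product in Q.\<close>
      also have "\<dots> = x [^]\<^bsub>A\<^esub> e \<otimes>\<^bsub>A\<^esub> (x \<otimes>\<^bsub>A\<^esub> ?e)"
        using assms(4) ev(1) by (simp add: Suc A.m_assoc)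
      also have "\<dots> \<in> Q"
        using assms(4) by (intro Q.I_l_closed[OF ev(2)]) simp
      finally show ?thesis
        using special_idealD[OF assms(3) P, of "\<lambda>i. x \<otimes>\<^bsub>A\<^esub> a i" "x \<otimes>\<^bsub>A\<^esub> b"] a b assms(4)
        by auto
    qed
  qed
  then show ?thesis
    using A.ideal_colon[OF Q.is_ideal assms(4)] by (auto simp: special_ideal_def)
qed

section \<open>Special primes from maximality\<close>

text \<open>Specialness tests one value P(a, b) at a time, so it passes to the union from any member
  containing that value. The chain condition enters through the ideal property.\<close>

lemma special_ideal_Union_chain:
  assumes "ring A" "C \<noteq> {}" "subset.chain {J. special_ideal K A J} C"
  shows "special_ideal K A (\<Union>C)"
proof -
  have C: "special_ideal K A J" if "J \<in> C" for J
    using assms(3) that by (auto simp: subset.chain_def)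
  have "subset.chain {J. ideal J A} C"
    using assms(3) by (auto simp: subset.chain_def special_ideal_def)
  then have "ideal (\<Union>C) A"
    using ring.chain_Union_is_ideal[OF assms(1), of C] assms(2) by simp
  moreover have "b \<in> \<Union>C"
    if "P \<in> homogeneous_signature K n" "a \<in> {1..n} \<rightarrow> carrier A" "b \<in> carrier A"
      and ev: "signature_eval K A (\<lambda>c. c \<odot>\<^bsub>A\<^esub> \<one>\<^bsub>A\<^esub>) P a b \<in> \<Union>C" for n P a b
  proof -
    obtain J where J: "J \<in> C" "signature_eval K A (\<lambda>c. c \<odot>\<^bsub>A\<^esub> \<one>\<^bsub>A\<^esub>) P a b \<in> J"
      using ev by blast
    have "b \<in> J"
      by (rule special_idealD[OF C[OF J(1)] that(1-3) J(2)])
    with J(1) show ?thesis by (rule UnionI)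
  qed
  ultimately show ?thesis
    by (simp add: special_ideal_def)
qed

lemma primeideal_maximal_special:
  assumes "field K" "algebra K A" "special_ideal K A Q" "b \<in> carrier A" "b \<notin> Q"
    and max: "\<And>J. special_ideal K A J \<Longrightarrow> Q \<subseteq> J \<Longrightarrow> b \<notin> J \<Longrightarrow> J = Q"
  shows "primeideal Q A"
proof -
  interpret A: cring A using assms(2) by (rule algebra.M_cring)
  interpret alg: algebra K A by fact
  interpret Q: ideal Q A using assms(3) by (simp add: special_ideal_def)
  \<comment> \<open>The colon ideal is special, contains Q and omits b, so maximality
    applies.\<close>
  have colon: "{z \<in> carrier A. x \<otimes>\<^bsub>A\<^esub> z \<in> Q} = Q" if "x \<in> carrier A" "x \<otimes>\<^bsub>A\<^esub> b \<notin> Q" for x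
    using that special_ideal_colon[OF assms(1-3) that(1)]
    by (intro max) (auto intro: Q.I_l_closed Q.Icarr)
  have "b \<otimes>\<^bsub>A\<^esub> b \<notin> Q"
    using special_ideal_square[OF assms(1-4)] assms(5) by blast
  note colon_b = colon[OF assms(4) this]
  show ?thesis
  proof (rule primeidealI)
    show "carrier A \<noteq> Q" using assms(4,5) by blast
    fix x y assume xy: "x \<in> carrier A" "y \<in> carrier A" "x \<otimes>\<^bsub>A\<^esub> y \<in> Q"
    show "x \<in> Q \<or> y \<in> Q"
    proof (cases "x \<otimes>\<^bsub>A\<^esub> b \<in> Q")
      case True
      \<comment> \<open>Here x lies in the colon ideal of b, which equals Q.\<close>
      then show ?thesis using colon_b xy(1) assms(4) by (auto simp: A.m_comm)
    next
      case False
      \<comment> \<open>Here y lies in the colon ideal of x, which equals Q.\<close>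
      then show ?thesis using colon[OF xy(1)] xy by blast
    qed
  qed (auto intro: Q.is_ideal A.cring_axioms)
qed

text \<open>Zorn's lemma supplies the maximal Q. The resulting prime witnesses that b is outside the
  special radical of I.\<close>

lemma special_prime_avoiding:
  assumes "field K" "algebra K A" "special_ideal K A I" "b \<in> carrier A" "b \<notin> I"
  obtains Q where "primeideal Q A" "special_ideal K A Q" "I \<subseteq> Q" "b \<notin> Q"
proof -
  interpret A: cring A using assms(2) by (rule algebra.M_cring)
  interpret alg: algebra K A by fact
  let ?S = "{J. special_ideal K A J \<and> I \<subseteq> J \<and> b \<notin> J}"
  have "\<exists>Q\<in>?S. \<forall>J\<in>?S. Q \<subseteq> J \<longrightarrow> J = Q"
  proof (rule subset_Zorn_nonempty)
    show "?S \<noteq> {}" using assms(3,5) by blast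
    fix C assume C: "C \<noteq> {}" "subset.chain ?S C"
    then have "subset.chain {J. special_ideal K A J} C"
      by (auto simp: subset.chain_def)
    then have "special_ideal K A (\<Union>C)"
      using special_ideal_Union_chain[OF A.ring_axioms C(1)] by blast
    \<comment> \<open>Some member of the nonempty C contains I, and no member contains b.\<close>
    then show "\<Union>C \<in> ?S"
      using C by (auto simp: subset.chain_def)
  qed
  then obtain Q where "Q \<in> ?S" and max: "\<forall>J\<in>?S. Q \<subseteq> J \<longrightarrow> J = Q" ..
  then have Q: "special_ideal K A Q" "I \<subseteq> Q" "b \<notin> Q"
    by auto
  have "primeideal Q A"
    \<comment> \<open>Every J above Q contains I, so maximality within \<open>?S\<close> is
      maximality among all special ideals omitting b.\<close>
    using max Q(2) by (intro primeideal_maximal_special[OF assms(1,2) Q(1) assms(4) Q(3)]) auto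
  then show thesis using Q by (rule that)
qed

theorem corollary5p5:
  fixes K :: "('k, 'm) ring_scheme"
    and A :: "('k, 'a, 'n) module_scheme"
    and I :: "'a set"
  assumes "field K" and "algebra K A" and "ideal I A"
  shows "special_ideal K A I \<longleftrightarrow> I = special_radical K A I"
proof
  assume "special_ideal K A I"
  then show "I = special_radical K A I"
    using special_prime_avoiding[OF assms(1,2)] ideal.Icarr[OF assms(3)]
    unfolding special_radical_def by blast
next
  assume rad: "I = special_radical K A I"
  have "b \<in> I" if "P \<in> homogeneous_signature K n" "a \<in> {1..n} \<rightarrow> carrier A" "b \<in> carrier A"
    "signature_eval K A (\<lambda>c. c \<odot>\<^bsub>A\<^esub> \<one>\<^bsub>A\<^esub>) P a b \<in> I" for n P a b
  proof -
    \<comment> \<open>The value P(a, b) lies in each special Q above I, hence so does b: specialness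
      survives intersections.\<close>
    have "b \<in> Q" if "special_ideal K A Q" "I \<subseteq> Q" for Q
      using special_idealD[OF that(1)] that(2) \<open>P \<in> _\<close> \<open>a \<in> _\<close> \<open>b \<in> carrier A\<close>
        \<open>signature_eval K A _ P a b \<in> I\<close> by blast
    \<comment> \<open>If no special prime contains I, the radical is all of
      \<open>carrier A\<close>, which contains b.\<close>
    then have "b \<in> special_radical K A I"
      using \<open>b \<in> carrier A\<close> by (auto simp: special_radical_def)
    then show ?thesis using rad by simp
  qed
  then show "special_ideal K A I"
    using assms(3) by (simp add: special_ideal_def)
qed

end
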